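(* Let $(T_n)_{n\in\mathbb{Z}}$ be the Tribonacci numbers. The following six identities hold for every non-negative integer $k$, every integer $m$ and every integer $r\notin\{-17,-4,-1,0\}$: $$\sum_{j=0}^{k}\sum_{s=0}^{j}\binom{k}{j}\binom{j}{s}(T_{r-1}+T_r)^{j-s}\,\frac{T_{r+1}^{\,s}}{T_r^{\,j}}\,T_{m-(r+2)k+j+s} = \frac{T_m}{T_r^{\,k}},$$ $$\sum_{j=0}^{k}\sum_{s=0}^{j}\binom{k}{j}\binom{j}{s}\frac{T_r^{\,j-s}T_{r+1}^{\,s}}{(T_{r-1}+T_r)^{j}}\,T_{m-(r+1)k-j+2s} = \frac{T_m}{(T_{r-1}+T_r)^{k}},$$ $$\sum_{j=0}^{k}\sum_{s=0}^{j}\binom{k}{j}\binom{j}{s}\frac{T_{r-1}^{\,j-s}(T_{r-2}+T_{r-1})^{s}}{T_r^{\,j}}\,T_{m-(r-1)k-2j+s} = \frac{T_m}{T_r^{\,k}},$$ $$\sum_{j=0}^{k}\sum_{s=0}^{j}(-1)^s\binom{k}{j}\binom{j}{s}\frac{(T_{r-1}+T_r)^{j-s}}{T_r^{\,j}}\,T_{m-2k+j+(r+1)s} = (-1)^k\left(\frac{T_{r+1}}{T_r}\right)^{k}T_m,$$ $$\sum_{j=0}^{k}\sum_{s=0}^{j}(-1)^s\binom{k}{j}\binom{j}{s}\frac{T_{r+1}^{\,j-s}}{T_r^{\,j}}\,T_{m-k+2j+rs} = (-1)^k\left(\frac{T_{r-1}+T_r}{T_r}\right)^{k}T_m,$$ $$\sum_{j=0}^{k}\sum_{s=0}^{j}(-1)^s\binom{k}{j}\binom{j}{s}\frac{T_{r+1}^{\,j-s}}{(T_{r-1}+T_r)^{j}}\,T_{m+k+j+rs}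 = (-1)^k\left(\frac{T_r}{T_{r-1}+T_r}\right)^{k}T_m.$$
   Context: The Tribonacci numbers are defined by $T_0=0$, $T_1=T_2=1$ and $T_m=T_{m-1}+T_{m-2}+T_{m-3}$ for $m\ge 3$. They are extended to negative subscripts by $T_{-m}=2T_{-m+3}-T_{-m+4}$ for $m\ge 1$. Here $T_n^{\,j}$ denotes the $j$-th power of $T_n$.
   Formalization: The second and sixth identities are stated only for r ≠ -2, because at r = -2 their denominator T_{r-1}+T_r = T_{-3}+T_{-2} = -1+1 is zero and they are undefined. *)

theory Defs
  imports Complex_Main
begin

function trib :: "int \<Rightarrow> int" where
  "trib m =
     (if m < 0 then 2 * trib (m + 3) - trib (m + 4)
      else if m = 0 then 0
      else if m \<le> 2 then 1
      else trib (m - 1) + trib (m - 2) + trib (m - 3))"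
  by auto
termination
  by (relation "measure (\<lambda>m. if m < 0 then nat (4 - m) else nat m)") auto

declare trib.simps [simp del]

lemma trib_0: "trib 0 = 0"
  and trib_1: "trib 1 = 1"
  and trib_2: "trib 2 = 1"
  by (simp_all add: trib.simps)

lemma trib_rec: "m \<ge> 3 \<Longrightarrow> trib m = trib (m - 1) + trib (m - 2) + trib (m - 3)"
  by (subst trib.simps) simp

lemma trib_neg: "m \<ge> 1 \<Longrightarrow> trib (- m) = 2 * trib (- m + 3) - trib (- m + 4)"
  by (subst trib.simps) simp

(* The sum trib (r - 1) + trib r, used as a denominator in some of the identities,
   vanishes at r = -2, hence the proviso on those identities. *)
lemma trib_denominator_zero: "trib (- 3) + trib (- 2) = 0"
proof -
  have "trib (- 1) = 0" "trib (- 2) = 1"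
    using trib_rec[of 3] trib_neg[of 1] trib_neg[of 2] by (simp_all add: trib_0 trib_1 trib_2)
  then show ?thesis
    using trib_neg[of 3] by (simp add: trib_0 trib_1)
qed

end

theory Submission
  imports Defs "HOL-Computational_Algebra.Primes"
begin

text \<open>
  All six identities are one statement. Every sequence \<open>f\<close> with the Tribonacci recurrence, on all
  integers, satisfies
  \<open>f (m + r + 2) = T\<^sub>r f m + (T\<^bsub>r-1\<^esub> + T\<^sub>r) f (m + 1) + T\<^bsub>r+1\<^esub> f (m + 2)\<close>
  (lemma \<open>tribonacci_like_addition\<close>): as functions of \<open>r\<close> both sides obey the recurrence, and they
  agree at three consecutive arguments. Read as an equation between powers of the shift operator
  \<open>E\<close>, this expresses \<open>E ^ (r + 2)\<close> by \<open>1, E, E ^ 2\<close>. Solving for one of the four terms, raising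
  to the \<open>k\<close>-th power with the trinomial theorem and applying the result to \<open>T\<close> gives an identity
  (lemma \<open>trinomial_expansion_quotient\<close>); the choice of the isolated term, of the term used as
  denominator, and of \<open>r\<close> or \<open>r - 1\<close> produces the six.

  The denominators \<open>T\<^sub>r\<close> and \<open>T\<^bsub>r-1\<^esub> + T\<^sub>r\<close> must not vanish, and this is the deep part. The zeros of
  \<open>T\<close> are \<open>0, -1, -4, -17\<close>, and those of \<open>T\<^bsub>n-1\<^esub> + T\<^sub>n\<close> are \<open>0, -2\<close>. They are found with Skolem's
  \<open>p\<close>-adic method. Let \<open>N\<close> be a period of \<open>T\<close> modulo an odd prime \<open>p\<close>. Then \<open>E ^ N = 1 + p B\<close> on
  Tribonacci-like integer sequences, with an operator \<open>B\<close> that preserves them, so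
  \<open>f (i + n N) = f i + n p (B f) i + (n choose 2) p\<^sup>2 (B\<^sup>2 f) i + \<dots>\<close>.
  If \<open>f i = 0\<close> and \<open>p\<close> does not divide \<open>(B f) i\<close>, the linear term has a smaller \<open>p\<close>-adic valuation
  than all later ones, so the sum is nonzero for \<open>n \<noteq> 0\<close>: the zero \<open>i\<close> is alone in its residue
  class modulo \<open>N\<close> (lemma \<open>unique_zero_in_class\<close>). The other classes modulo \<open>N\<close> in which \<open>p\<close> divides
  \<open>f\<close> are left to a second prime: either they are incompatible with the classes that it allows, or
  it isolates the zero in the same way. The primes \<open>29, 17\<close> suffice for \<open>T\<close>, and \<open>29, 19\<close> for
  \<open>T\<^bsub>n-1\<^esub> + T\<^sub>n\<close>.
\<close>

section \<open>Sequences with the Tribonacci recurrence\<close>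

definition tribonacci_like :: "(int \<Rightarrow> 'a::comm_ring_1) \<Rightarrow> bool" where
  "tribonacci_like f \<longleftrightarrow> (\<forall>m. f (m + 3) = f (m + 2) + f (m + 1) + f m)"

lemma tribonacci_like_forward:
  assumes "tribonacci_like f"
  shows "f m = f (m - 1) + f (m - 2) + f (m - 3)"
proof -
  have "f ((m - 3) + 3) = f ((m - 3) + 2) + f ((m - 3) + 1) + f (m - 3)"
    using assms unfolding tribonacci_like_def by blast
  then show ?thesis by simp
qed

lemma tribonacci_like_backward:
  assumes "tribonacci_like f"
  shows "f m = f (m + 3) - f (m + 2) - f (m + 1)"
  using assms unfolding tribonacci_like_def by simp

lemma tribonacci_like_shift:
  assumes "tribonacci_like f"
  shows "tribonacci_like (\<lambda>n. f (n + d))"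
  unfolding tribonacci_like_def
proof
  fix m
  have "f ((m + d) + 3) = f ((m + d) + 2) + f ((m + d) + 1) + f (m + d)"
    using assms unfolding tribonacci_like_def by blast
  then show "f (m + 3 + d) = f (m + 2 + d) + f (m + 1 + d) + f (m + d)"
    by (simp only: ac_simps)
qed

lemma tribonacci_like_add:
  "tribonacci_like f \<Longrightarrow> tribonacci_like g \<Longrightarrow> tribonacci_like (\<lambda>n. f n + g n)"
  unfolding tribonacci_like_def by simp

lemma tribonacci_like_diff:
  "tribonacci_like f \<Longrightarrow> tribonacci_like g \<Longrightarrow> tribonacci_like (\<lambda>n. f n - g n)"
  unfolding tribonacci_like_def by simp

lemma tribonacci_like_mult_right: "tribonacci_like f \<Longrightarrow> tribonacci_like (\<lambda>n. f n * c)"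
  unfolding tribonacci_like_def by (simp add: algebra_simps)

lemma tribonacci_like_of_int: "tribonacci_like f \<Longrightarrow> tribonacci_like (\<lambda>n. of_int (f n))"
  unfolding tribonacci_like_def by simp

text \<open>
  For negative subscripts the defining recurrence \<open>T\<^sub>l = 2 T\<^bsub>l+3\<^esub> - T\<^bsub>l+4\<^esub>\<close> looks different; it is
  the difference of two neighbouring instances of the Tribonacci recurrence. Hence downward
  induction transports the recurrence from \<open>m + 1\<close> to \<open>m\<close>.
\<close>

lemma tribonacci_like_trib: "tribonacci_like trib"
  unfolding tribonacci_like_def
proof
  fix m :: int
  show "trib (m + 3) = trib (m + 2) + trib (m + 1) + trib m"
  proof (cases "m \<ge> 0")
    case True
    then show ?thesis using trib_rec[of "m + 3"] by (simp add: algebra_simps)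
  next
    case False
    have step: "trib l = 2 * trib (l + 3) - trib (l + 4)" if "l < 0" for l
      using trib_neg[of "- l"] that by (simp add: add.commute)
    have "trib (- int n + 3) = trib (- int n + 2) + trib (- int n + 1) + trib (- int n)" for n
    proof (induction n)
      case 0
      then show ?case using trib_rec[of 3] by simp
    next
      case (Suc n)
      then show ?case using step[of "- int (Suc n)"] by (simp add: algebra_simps)
    qed
    from this[of "nat (- m)"] False show ?thesis by simp
  qed
qed

lemma tribonacci_like_eqI:
  assumes f: "tribonacci_like f" and g: "tribonacci_like g"
    and init: "f 0 = g 0" "f 1 = g 1" "f 2 = g 2"
  shows "f n = g n"
proof -
  have "f n = g n \<and> f (n + 1) = g (n + 1) \<and> f (n + 2) = g (n + 2)"
  proof (induction n rule: int_induct[where k = 0])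
    case base
    then show ?case using init by simp
  next
    case (step1 i)
    then show ?case
      using f g unfolding tribonacci_like_def by (simp add: add.assoc)
  next
    case (step2 i)
    have "h (i - 1) = h (i + 2) - h (i + 1) - h i"
      if "tribonacci_like h" for h :: "int \<Rightarrow> 'a"
      using tribonacci_like_backward[OF that, of "i - 1"] by (simp add: add.commute)
    from this[OF f] this[OF g] step2 show ?case by (simp add: add.commute)
  qed
  then show ?thesis by blast
qed

lemma trib_negative_values:
  "trib (- 1) = 0" "trib (- 2) = 1" "trib (- 3) = - 1" "trib (- 4) = 0" "trib (- 17) = 0"
  by (simp_all add: trib.simps)

text \<open>
  Both sides, as functions of \<open>n = r + 2\<close>, are Tribonacci-like, so it is enough to compare them for
  \<open>n = 0, 1, 2\<close>, where the coefficient triples are the three unit vectors.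
\<close>

lemma tribonacci_like_addition:
  assumes f: "tribonacci_like f"
  shows "f (m + r + 2) = of_int (trib r) * f m + of_int (trib (r - 1) + trib r) * f (m + 1)
           + of_int (trib (r + 1)) * f (m + 2)"
proof -
  define g where "g n = of_int (trib (n - 2)) * f m
    + of_int (trib (n - 2 - 1) + trib (n - 2)) * f (m + 1) + of_int (trib (n - 2 + 1)) * f (m + 2)" for n
  have shift: "tribonacci_like (\<lambda>n. trib (n + d))" for d
    by (rule tribonacci_like_shift[OF tribonacci_like_trib])
  have "tribonacci_like g"
    unfolding g_def
  proof (intro tribonacci_like_add tribonacci_like_mult_right)
    show "tribonacci_like (\<lambda>n. of_int (trib (n - 2)) :: 'a)"
      using tribonacci_like_of_int[OF shift[of "- 2"]] by simp
    show "tribonacci_like (\<lambda>n. of_int (trib (n - 2 - 1) + trib (n - 2)) :: 'a)"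
      using tribonacci_like_of_int[OF tribonacci_like_add[OF shift[of "- 3"] shift[of "- 2"]]] by simp
    show "tribonacci_like (\<lambda>n. of_int (trib (n - 2 + 1)) :: 'a)"
      using tribonacci_like_of_int[OF shift[of "- 1"]] by simp
  qed
  then have "f (m + (r + 2)) = g (r + 2)"
  proof (rule tribonacci_like_eqI[rotated])
    show "tribonacci_like (\<lambda>n. f (m + n))"
      using tribonacci_like_shift[OF f, of m] by (simp add: add.commute)
    show "f (m + 0) = g 0" "f (m + 1) = g 1" "f (m + 2) = g 2"
      by (simp_all add: g_def trib_0 trib_1 trib_negative_values)
  qed
  then show ?thesis by (simp add: g_def add.assoc)
qed

section \<open>Binomial expansions\<close>

text \<open>
  Pascal's rule, summed: the only form in which the binomial coefficients enter the expansions below.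
\<close>

lemma sum_binomial_Suc:
  fixes g :: "nat \<Rightarrow> nat \<Rightarrow> 'a::comm_ring_1"
  shows "(\<Sum>j\<le>Suc k. of_nat (Suc k choose j) * g (Suc k - j) j) =
         (\<Sum>j\<le>k. of_nat (k choose j) * (g (Suc (k - j)) j + g (k - j) (Suc j)))"
proof -
  have "(\<Sum>j\<le>Suc k. of_nat (Suc k choose j) * g (Suc k - j) j)
      = g (Suc k) 0 + (\<Sum>j\<le>k. of_nat (k choose j) * g (k - j) (Suc j))
        + (\<Sum>j\<le>k. of_nat (k choose Suc j) * g (k - j) (Suc j))"
    by (subst sum.atMost_Suc_shift) (simp add: sum.distrib algebra_simps)
  also have "g (Suc k) 0 + (\<Sum>j\<le>k. of_nat (k choose j) * g (k - j) (Suc j))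
        + (\<Sum>j\<le>k. of_nat (k choose Suc j) * g (k - j) (Suc j))
      = (\<Sum>j\<le>k. of_nat (k choose j) * g (k - j) (Suc j))
        + (\<Sum>j\<le>Suc k. of_nat (k choose j) * g (Suc k - j) j)"
    by (simp only: sum.atMost_Suc_shift[of _ k]) (simp add: algebra_simps)
  also have "(\<Sum>j\<le>Suc k. of_nat (k choose j) * g (Suc k - j) j)
      = (\<Sum>j\<le>k. of_nat (k choose j) * g (Suc (k - j)) j)"
    by (simp add: binomial_eq_0 Suc_diff_le)
  finally show ?thesis by (simp add: sum.distrib algebra_simps)
qed

text \<open>
  The binomial theorem for commuting linear operators without operators. Think of \<open>W k a b\<close> as
  \<open>(X + Y) ^ k X ^ a Y ^ b\<close> applied to a fixed argument; the hypothesis is then the expansion of one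
  factor \<open>X + Y\<close>, and linearity and commutation are hidden in the indices.
\<close>

lemma binomial_expansion:
  fixes W :: "nat \<Rightarrow> nat \<Rightarrow> nat \<Rightarrow> 'a::comm_ring_1"
  assumes W: "\<And>k a b. W (Suc k) a b = W k (Suc a) b + W k a (Suc b)"
  shows "W k 0 0 = (\<Sum>j\<le>k. of_nat (k choose j) * W 0 (k - j) j)"
proof -
  (* Only the first k of the k' factors are expanded, so that the induction needs W at (0, 0) alone. *)
  have "W k' 0 0 = (\<Sum>j\<le>k. of_nat (k choose j) * W (k' - k) (k - j) j)" if "k \<le> k'" for k'
    using that
  proof (induction k)
    case (Suc k)
    then have "W (k' - k) a b = W (k' - Suc k) (Suc a) b + W (k' - Suc k) a (Suc b)" for a b
      using W[of "k' - Suc k" a b] by (simp add: Suc_diff_Suc)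
    with Suc show ?case
      using sum_binomial_Suc[of k "W (k' - Suc k)"] by simp
  qed simp
  from this[of k] show ?thesis by simp
qed

text \<open>
  The hypothesis says \<open>y E ^ d = x\<^sub>0 E ^ d\<^sub>0 + x\<^sub>1 E ^ d\<^sub>1 + x\<^sub>2 E ^ d\<^sub>2\<close> on \<open>f\<close>, with \<open>E\<close> the shift. The
  \<open>k\<close>-th power is a binomial expansion in the first summand and the remaining pair, whose powers
  are binomial expansions in turn.
\<close>

lemma trinomial_expansion:
  fixes f :: "int \<Rightarrow> 'a::comm_ring_1"
  assumes rel: "\<And>m. y * f (m + d) = x\<^sub>0 * f (m + d\<^sub>0) + x\<^sub>1 * f (m + d\<^sub>1) + x\<^sub>2 * f (m + d\<^sub>2)"
  shows "y ^ k * f (m + int k * d) =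
    (\<Sum>j=0..k. \<Sum>s=0..j. of_nat (k choose j) * of_nat (j choose s)
       * (x\<^sub>0 ^ (k - j) * x\<^sub>1 ^ (j - s) * x\<^sub>2 ^ s)
       * f (m + int (k - j) * d\<^sub>0 + int (j - s) * d\<^sub>1 + int s * d\<^sub>2))"
proof -
  define w where "w k a b c = y ^ k * x\<^sub>0 ^ a * x\<^sub>1 ^ b * x\<^sub>2 ^ c
    * f (m + int k * d + int a * d\<^sub>0 + int b * d\<^sub>1 + int c * d\<^sub>2)" for k a b c
  have w: "w (Suc k) a b c = w k (Suc a) b c + w k a (Suc b) c + w k a b (Suc c)" for k a b c
  proof -
    let ?n = "m + int k * d + int a * d\<^sub>0 + int b * d\<^sub>1 + int c * d\<^sub>2"
    have "w (Suc k) a b c = y ^ k * x\<^sub>0 ^ a * x\<^sub>1 ^ b * x\<^sub>2 ^ c * (y * f (?n + d))"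
      by (simp add: w_def algebra_simps)
    also have "\<dots> = w k (Suc a) b c + w k a (Suc b) c + w k a b (Suc c)"
      unfolding rel by (simp add: w_def algebra_simps)
    finally show ?thesis .
  qed
  define W where "W k a l = (\<Sum>s\<le>l. of_nat (l choose s) * w k a (l - s) s)" for k a l
  have "W (Suc k) a l = W k (Suc a) l + W k a (Suc l)" for k a l
    unfolding W_def sum_binomial_Suc w by (simp add: sum.distrib algebra_simps)
  from binomial_expansion[of W, OF this]
  have "w k 0 0 0 = (\<Sum>j\<le>k. of_nat (k choose j) * (\<Sum>s\<le>j. of_nat (j choose s) * w 0 (k - j) (j - s) s))"
    by (simp add: W_def)
  then show ?thesis
    by (simp add: w_def sum_distrib_left atLeast0AtMost mult.assoc)
qed

text \<open>
  The shape shared by the six identities: the first of the three coefficients is divided out, and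
  the exponents of the shift are collected along \<open>k\<close>, \<open>j\<close> and \<open>s\<close>.
\<close>

corollary trinomial_expansion_quotient:
  fixes f :: "int \<Rightarrow> real"
  assumes q: "q \<noteq> 0"
    and rel: "\<And>m. y * f (m + d) = q * f (m + d\<^sub>0) + x\<^sub>1 * f (m + d\<^sub>1) + x\<^sub>2 * f (m + d\<^sub>2)"
  shows "(\<Sum>j=0..k. \<Sum>s=0..j. real (k choose j) * real (j choose s)
           * (x\<^sub>1 ^ (j - s) * x\<^sub>2 ^ s / q ^ j)
           * f (m + d\<^sub>0 * int k + (d\<^sub>1 - d\<^sub>0) * int j + (d\<^sub>2 - d\<^sub>1) * int s))
         = (y / q) ^ k * f (m + d * int k)"
proof -
  have rel': "y / q * f (m + d) = 1 * f (m + d\<^sub>0) + x\<^sub>1 / q * f (m + d\<^sub>1) + x\<^sub>2 / q * f (m + d\<^sub>2)" for m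
    using rel[of m] q by (simp add: field_simps)
  have "(y / q) ^ k * f (m + d * int k) = (\<Sum>j=0..k. \<Sum>s=0..j. real (k choose j) * real (j choose s)
      * (1 ^ (k - j) * (x\<^sub>1 / q) ^ (j - s) * (x\<^sub>2 / q) ^ s)
      * f (m + int (k - j) * d\<^sub>0 + int (j - s) * d\<^sub>1 + int s * d\<^sub>2))"
    using trinomial_expansion[of _ f, OF rel', of k m] by (simp add: mult.commute[of d])
  also have "\<dots> = (\<Sum>j=0..k. \<Sum>s=0..j. real (k choose j) * real (j choose s)
      * (x\<^sub>1 ^ (j - s) * x\<^sub>2 ^ s / q ^ j)
      * f (m + d\<^sub>0 * int k + (d\<^sub>1 - d\<^sub>0) * int j + (d\<^sub>2 - d\<^sub>1) * int s))"
  proof (intro sum.cong refl)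
    fix j s assume "j \<in> {0..k}" "s \<in> {0..j}"
    then have js: "j \<le> k" "s \<le> j" by auto
    then have "q ^ j = q ^ (j - s) * q ^ s" by (simp flip: power_add)
    then have "1 ^ (k - j) * (x\<^sub>1 / q) ^ (j - s) * (x\<^sub>2 / q) ^ s = x\<^sub>1 ^ (j - s) * x\<^sub>2 ^ s / q ^ j"
      by (simp add: power_divide)
    moreover have "m + int (k - j) * d\<^sub>0 + int (j - s) * d\<^sub>1 + int s * d\<^sub>2
        = m + d\<^sub>0 * int k + (d\<^sub>1 - d\<^sub>0) * int j + (d\<^sub>2 - d\<^sub>1) * int s"
      using js by (simp add: of_nat_diff algebra_simps)
    ultimately show "real (k choose j) * real (j choose s)
          * (1 ^ (k - j) * (x\<^sub>1 / q) ^ (j - s) * (x\<^sub>2 / q) ^ s)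
          * f (m + int (k - j) * d\<^sub>0 + int (j - s) * d\<^sub>1 + int s * d\<^sub>2)
        = real (k choose j) * real (j choose s) * (x\<^sub>1 ^ (j - s) * x\<^sub>2 ^ s / q ^ j)
          * f (m + d\<^sub>0 * int k + (d\<^sub>1 - d\<^sub>0) * int j + (d\<^sub>2 - d\<^sub>1) * int s)"
      by (simp only:)
  qed
  finally show ?thesis by simp
qed

section \<open>Zeros in a residue class\<close>

text \<open>
  From \<open>j (n choose j) = n (n-1 choose j-1)\<close>, the binomial coefficient loses at most the valuation
  \<open>e\<close> of \<open>j\<close> against \<open>p ^ v\<close>. The factor \<open>p ^ j\<close> compensates this loss with two powers of \<open>p\<close> to
  spare, because \<open>j < p ^ (j - 1)\<close> gives \<open>e \<le> j - 2\<close>. This inequality fails for \<open>p = j = 2\<close>, so the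
  prime has to be odd.
\<close>

lemma prime_power_dvd_binomial_term:
  fixes p :: nat
  assumes p: "prime p" "p \<ge> 3" and v: "p ^ v dvd n" and j: "j \<ge> 2"
  shows "p ^ (v + 2) dvd (n choose j) * p ^ j"
proof (cases "n choose j = 0")
  case False
  have small: "j < p ^ (j - 1)"
    using j
  proof (induction j rule: dec_induct)
    case (step i)
    have "Suc i < 3 * p ^ (i - 1)" using step by linarith
    also have "\<dots> \<le> p * p ^ (i - 1)" using p by simp
    also have "\<dots> = p ^ (Suc i - 1)" using step by (cases i) auto
    finally show ?case .
  qed (use p in simp)
  define e where "e = multiplicity p j"
  have "p ^ e \<le> j"
    using j by (intro dvd_imp_le) (auto simp: e_def multiplicity_dvd)
  with small have "p ^ e < p ^ (j - 1)" by simp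
  then have e: "e + 2 \<le> j" using p j by (simp add: power_strict_increasing_iff)
  have "p ^ v dvd j * (n choose j)"
  proof (cases n; cases j)
    fix n' j' assume "n = Suc n'" "j = Suc j'"
    then have "j * (n choose j) = n * (n' choose j')"
      by (simp only: Suc_times_binomial)
    with v show ?thesis by simp
  qed (use j False in auto)
  then have "v \<le> multiplicity p (j * (n choose j))"
    using False j p by (intro multiplicity_geI) (auto simp: prime_gt_0_nat)
  also have "\<dots> = e + multiplicity p (n choose j)"
    using False j p by (simp add: e_def prime_elem_multiplicity_mult_distrib)
  finally have "v + 2 \<le> multiplicity p (n choose j) + j" using e by linarith
  then have "p ^ (v + 2) dvd p ^ (multiplicity p (n choose j) + j)" by (rule le_imp_power_dvd)
  also have "\<dots> dvd (n choose j) * p ^ j"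
    by (simp add: power_add multiplicity_dvd)
  finally show ?thesis .
qed (simp add: binomial_eq_0)

text \<open>
  The \<open>p\<close>-adic heart of the argument, for a table \<open>F k b\<close> that stands for \<open>(1 + p B) ^ k B ^ b\<close> at a
  fixed argument. With \<open>n = p ^ v u\<close> and \<open>u\<close> prime to \<open>p\<close>, all terms from the quadratic one on are
  divisible by \<open>p ^ (v + 2)\<close>. The whole sum and its constant term vanish, so \<open>p ^ (v + 2)\<close> divides
  the linear term \<open>n p F 0 1\<close> too, while \<open>n p\<close> accounts for \<open>p ^ (v + 1)\<close> only.
\<close>

lemma dvd_first_difference_of_two_zeros:
  fixes F :: "nat \<Rightarrow> nat \<Rightarrow> int" and p :: nat
  assumes p: "prime p" "p \<ge> 3"
    and F: "\<And>k b. F (Suc k) b = F k b + int p * F k (Suc b)"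
    and zeros: "F 0 0 = 0" "F n 0 = 0" and n: "n > 0"
  shows "int p dvd F 0 1"
proof -
  define v where "v = multiplicity p n"
  obtain u where u: "n = p ^ v * u" "\<not> p dvd u"
    using multiplicity_decompose'[of n p] n p unfolding v_def
    by (metis not_prime_unit neq0_conv)
  have "F n 0 = (\<Sum>j\<le>n. int (n choose j) * (int p ^ j * F 0 j))"
    using binomial_expansion[of "\<lambda>k a b. int p ^ b * F k b" n]
    by (simp add: F algebra_simps)
  also have "\<dots> = (\<Sum>j\<in>{0, 1} \<union> {2..n}. int (n choose j) * (int p ^ j * F 0 j))"
    using n by (intro sum.cong) auto
  also have "\<dots> = int n * int p * F 0 1 + (\<Sum>j=2..n. int (n choose j) * (int p ^ j * F 0 j))"
    using zeros by (subst sum.union_disjoint) auto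
  finally have eq: "int n * int p * F 0 1 = - (\<Sum>j=2..n. int (n choose j) * (int p ^ j * F 0 j))"
    using zeros by simp
  have "int p ^ (v + 2) dvd int (n choose j) * (int p ^ j * F 0 j)" if "j \<in> {2..n}" for j
  proof -
    have "p ^ (v + 2) dvd (n choose j) * p ^ j"
      using that u by (intro prime_power_dvd_binomial_term[OF p]) auto
    then have "int p ^ (v + 2) dvd int (n choose j) * int p ^ j"
      by (metis of_nat_dvd_iff of_nat_mult of_nat_power)
    then show ?thesis by (metis dvd_mult2 mult.assoc)
  qed
  then have "int p ^ (v + 2) dvd int n * int p * F 0 1"
    unfolding eq by (simp only: dvd_minus_iff) (rule dvd_sum)
  then have "int p ^ (v + 1) * int p dvd int p ^ (v + 1) * (int u * F 0 1)"
    by (simp add: u algebra_simps)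
  then have "int p dvd int u * F 0 1"
    using p by (subst (asm) dvd_mult_cancel_left) auto
  then show ?thesis
    using p u by (simp add: prime_dvd_mult_iff)
qed

text \<open>
  Periodicity is demanded for all Tribonacci-like sequences at once, since it is applied to \<open>T\<close>,
  to \<open>T\<^bsub>n-1\<^esub> + T\<^sub>n\<close> and to the quotients \<open>(f (m + N) - f m) / p\<close> of such sequences.
\<close>

definition trib_period :: "nat \<Rightarrow> nat \<Rightarrow> bool" where
  "trib_period p N \<longleftrightarrow> (\<forall>f m. tribonacci_like f \<longrightarrow> int p dvd f (m + int N) - (f m :: int))"

text \<open>
  Periodicity of \<open>T\<close> at one place is enough, because by the addition formula the coefficients that
  express \<open>f (m + N)\<close> are values of \<open>T\<close> around \<open>N\<close>.
\<close>

lemma trib_periodI: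
  assumes "int p dvd trib (int N)" "int p dvd trib (int N + 1) - 1" "int p dvd trib (int N + 2) - 1"
  shows "trib_period p N"
  unfolding trib_period_def
proof (intro allI impI)
  fix f :: "int \<Rightarrow> int" and m :: int
  assume f: "tribonacci_like f"
  let ?n = "int N"
  have rec: "trib (?n + 2) = trib (?n + 1) + trib ?n + trib (?n - 1)"
      "trib (?n + 1) = trib ?n + trib (?n - 1) + trib (?n - 2)"
    using tribonacci_like_forward[OF tribonacci_like_trib, of "?n + 2"]
      tribonacci_like_forward[OF tribonacci_like_trib, of "?n + 1"] by (simp_all add: add.commute)
  have 1: "int p dvd trib (?n - 1)"
    using dvd_diff[OF dvd_diff[OF assms(3) assms(2)] assms(1)] rec(1) by simp
  have 2: "int p dvd trib (?n - 2) - 1"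
    using dvd_diff[OF dvd_diff[OF assms(2) assms(1)] 1] rec(2) by (simp add: algebra_simps)
  have 3: "int p dvd trib (?n - 3) + trib (?n - 2)"
    using dvd_diff[OF assms(1) 1] tribonacci_like_forward[OF tribonacci_like_trib, of ?n]
    by (simp add: add.commute)
  have "f (m + ?n) - f m = (trib (?n - 2) - 1) * f m + (trib (?n - 3) + trib (?n - 2)) * f (m + 1)
      + trib (?n - 1) * f (m + 2)"
    using tribonacci_like_addition[OF f, of m "?n - 2"] by (simp add: algebra_simps)
  then show "int p dvd f (m + ?n) - f m"
    using 1 2 3 by simp
qed

lemma trib_period_dvd_iff:
  assumes "trib_period p N" "tribonacci_like f"
  shows "int p dvd f (m + int N * i) \<longleftrightarrow> int p dvd f m"
proof -
  have step: "int p dvd f (l + int N) \<longleftrightarrow> int p dvd f l" for l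
  proof -
    have "int p dvd f (l + int N) - f l"
      using assms unfolding trib_period_def by blast
    from dvd_add_right_iff[OF this, of "f l"] show ?thesis by simp
  qed
  show ?thesis
  proof (induction i rule: int_induct[where k = 0])
    case (step1 i)
    then show ?case using step[of "m + int N * i"] by (simp add: algebra_simps)
  next
    case (step2 i)
    then show ?case using step[of "m + int N * (i - 1)"] by (simp add: algebra_simps)
  qed simp
qed

text \<open>
  The difference quotient \<open>B g = (E ^ N g - g) / p\<close> is again Tribonacci-like, so it can be iterated,
  and \<open>E ^ N = 1 + p B\<close> feeds the \<open>p\<close>-adic lemma with \<open>F k b = (B ^ b f) (i + N k)\<close>.
\<close>

lemma two_zeros_in_class:
  fixes f :: "int \<Rightarrow> int"
  assumes p: "prime p" "p \<ge> 3" and period: "trib_period p N" and f: "tribonacci_like f"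
    and zeros: "f i = 0" "f (i + int N * int n) = 0" and n: "n > 0"
  shows "int p dvd (f (i + int N) - f i) div int p"
proof -
  define B where "B g m = (g (m + int N) - g m) div int p" for g :: "int \<Rightarrow> int" and m
  have B: "g (m + int N) = g m + int p * B g m" if "tribonacci_like g" for g m
    using period that unfolding trib_period_def B_def by simp
  have B_trib: "tribonacci_like (B g)" if g: "tribonacci_like g" for g
  proof -
    have "int p * B g (m + 3) = int p * (B g (m + 2) + B g (m + 1) + B g m)" for m
      using B[OF g, of m] B[OF g, of "m + 1"] B[OF g, of "m + 2"] B[OF g, of "m + 3"] g
        tribonacci_like_shift[OF g, of "int N"]
      unfolding tribonacci_like_def by (simp add: algebra_simps)
    then show ?thesis using p unfolding tribonacci_like_def by simp
  qed
  have iter: "tribonacci_like ((B ^^ b) f)" for b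
    by (induction b) (simp_all add: f B_trib)
  have "int p dvd (B ^^ 1) f (i + int N * int 0)"
  proof (rule dvd_first_difference_of_two_zeros[OF p, where F = "\<lambda>k b. (B ^^ b) f (i + int N * int k)"])
    show "(B ^^ b) f (i + int N * int (Suc k))
        = (B ^^ b) f (i + int N * int k) + int p * (B ^^ Suc b) f (i + int N * int k)" for k b
      using B[OF iter[of b], of "i + int N * int k"] by (simp add: algebra_simps)
  qed (use zeros n in simp_all)
  then show ?thesis by (simp add: B_def)
qed

text \<open>
  The expansion only runs upwards, so it starts at the smaller of the two zeros. Divisibility of
  \<open>B f\<close> by \<open>p\<close> is then carried to \<open>i\<close> by periodicity, and at \<open>i\<close> it means \<open>p\<^sup>2\<close> divides
  \<open>f (i + N)\<close>.
\<close>

lemma unique_zero_in_class: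
  fixes f :: "int \<Rightarrow> int"
  assumes p: "prime p" "p \<ge> 3" and period: "trib_period p N" and f: "tribonacci_like f"
    and zeros: "f i = 0" "f j = 0" and same_class: "i mod int N = j mod int N"
    and simple: "\<not> int p ^ 2 dvd f (i + int N)"
  shows "j = i"
proof (rule ccontr)
  assume "j \<noteq> i"
  define B where "B m = (f (m + int N) - f m) div int p" for m
  have B: "f (m + int N) - f m = int p * B m" for m
    using period f unfolding trib_period_def B_def by simp
  have "tribonacci_like (\<lambda>m. int p * B m)"
    unfolding B[symmetric]
    by (intro tribonacci_like_diff tribonacci_like_shift f)
  then have B_trib: "tribonacci_like B"
    using p unfolding tribonacci_like_def by (simp flip: distrib_left)
  obtain t where t: "j = i + int N * t"
    using same_class by (metis mod_eqE)
  have "int p dvd B i"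
  proof (cases "t > 0")
    case True
    then show ?thesis
      using two_zeros_in_class[OF p period f zeros(1), of "nat t"] zeros t by (simp add: B_def)
  next
    case False
    with t \<open>j \<noteq> i\<close> have "t < 0" by (cases "t = 0") auto
    then have "int p dvd B j"
      using two_zeros_in_class[OF p period f zeros(2), of "nat (- t)"] zeros t by (simp add: B_def)
    then show ?thesis
      using trib_period_dvd_iff[OF period B_trib] t by simp
  qed
  then have "int p ^ 2 dvd f (i + int N)"
    using B[of i] zeros by (simp add: power2_eq_square)
  with simple show False by simp
qed

section \<open>Finding the zeros\<close>

fun tribonacci_iterate :: "nat \<Rightarrow> int \<Rightarrow> int \<Rightarrow> int \<Rightarrow> int" where
  "tribonacci_iterate 0 a b c = a"
| "tribonacci_iterate (Suc n) a b c = tribonacci_iterate n b c (a + b + c)"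

lemma tribonacci_iterate:
  assumes "tribonacci_like f"
  shows "tribonacci_iterate n (f m) (f (m + 1)) (f (m + 2)) = f (m + int n)"
proof (induction n arbitrary: m)
  case (Suc n)
  have "f m + f (m + 1) + f (m + 2) = f (m + 1 + 2)"
    using assms unfolding tribonacci_like_def by (simp add: add.assoc)
  then show ?case using Suc[of "m + 1"] by (simp add: algebra_simps)
qed simp

lemma trib_eval: "trib (int n) = tribonacci_iterate n 0 1 1"
  using tribonacci_iterate[OF tribonacci_like_trib, of n 0] by (simp add: trib_0 trib_1 trib_2)

text \<open>
  A sieve over one period that keeps only residues, so that the numbers stay below \<open>p\<close>. The
  arguments \<open>a, b, c\<close> are the residues of three consecutive terms, the first of them at place \<open>i\<close>.
\<close>

fun zero_residues :: "int \<Rightarrow> nat \<Rightarrow> int \<Rightarrow> int \<Rightarrow> int \<Rightarrow> int \<Rightarrow> int list" where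
  "zero_residues p 0 i a b c = []"
| "zero_residues p (Suc n) i a b c =
     (if a = 0 then [i] else []) @ zero_residues p n (i + 1) b c ((a + b + c) mod p)"

lemma zero_residues_complete:
  assumes "tribonacci_like f" "p dvd f j" "i \<le> j" "j < i + int n"
  shows "j \<in> set (zero_residues p n i (f i mod p) (f (i + 1) mod p) (f (i + 2) mod p))"
  using assms(3,4)
proof (induction n arbitrary: i)
  case (Suc n)
  have "f i + f (i + 1) + f (i + 2) = f (i + 1 + 2)"
    using assms unfolding tribonacci_like_def by (simp add: add.assoc)
  then have nxt: "(f i mod p + f (i + 1) mod p + f (i + 2) mod p) mod p = f (i + 1 + 2) mod p"
    by (metis mod_add_eq mod_add_left_eq)
  show ?case
  proof (cases "j = i")
    case True
    then show ?thesis using assms by simp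
  next
    case False
    then show ?thesis using Suc.IH[of "i + 1"] Suc.prems nxt by (simp add: add.assoc)
  qed
qed simp

lemma zero_mod_period:
  assumes period: "trib_period p N" and N: "N > 0" and f: "tribonacci_like f" and zero: "f n = 0"
  shows "n mod int N \<in> set (zero_residues (int p) N 0 (f 0 mod int p) (f 1 mod int p) (f 2 mod int p))"
proof -
  have "int p dvd f (n mod int N + int N * (n div int N))" using zero by simp
  then have "int p dvd f (n mod int N)"
    using trib_period_dvd_iff[OF period f] by blast
  from zero_residues_complete[OF f this, of 0 N] N show ?thesis by simp
qed

lemma trib_period_29: "trib_period 29 140"
  and trib_period_17: "trib_period 17 96"
  and trib_period_19: "trib_period 19 360"
proof -
  have "29 dvd tribonacci_iterate 140 0 1 1" "29 dvd tribonacci_iterate 141 0 1 1 - 1"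
    "29 dvd tribonacci_iterate 142 0 1 1 - 1" by code_simp+
  then have "29 dvd trib 140" "29 dvd trib 141 - 1" "29 dvd trib 142 - 1"
    using trib_eval[of 140] trib_eval[of 141] trib_eval[of 142] by simp_all
  then show "trib_period 29 140"
    using trib_periodI[of 29 140] by simp
  have "17 dvd tribonacci_iterate 96 0 1 1" "17 dvd tribonacci_iterate 97 0 1 1 - 1"
    "17 dvd tribonacci_iterate 98 0 1 1 - 1" by code_simp+
  then have "17 dvd trib 96" "17 dvd trib 97 - 1" "17 dvd trib 98 - 1"
    using trib_eval[of 96] trib_eval[of 97] trib_eval[of 98] by simp_all
  then show "trib_period 17 96"
    using trib_periodI[of 17 96] by simp
  have "19 dvd tribonacci_iterate 360 0 1 1" "19 dvd tribonacci_iterate 361 0 1 1 - 1"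
    "19 dvd tribonacci_iterate 362 0 1 1 - 1" by code_simp+
  then have "19 dvd trib 360" "19 dvd trib 361 - 1" "19 dvd trib 362 - 1"
    using trib_eval[of 360] trib_eval[of 361] trib_eval[of 362] by simp_all
  then show "trib_period 19 360"
    using trib_periodI[of 19 360] by simp
qed

text \<open>
  Modulo \<open>29\<close> the zeros \<open>0, -4, -1\<close> are alone in their classes \<open>0, 136, 139\<close> modulo \<open>140\<close>. The two
  remaining classes \<open>77\<close> and \<open>123\<close> are odd, \<open>123\<close> being that of \<open>-17\<close>, for which \<open>29\<^sup>2\<close> divides the
  shifted value and the criterion says nothing. The period \<open>96\<close> modulo \<open>17\<close> is even as well and
  leaves just two odd classes, those of \<open>-17\<close> and \<open>-1\<close>, where \<open>17\<close> does show uniqueness.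
\<close>

theorem trib_zeros:
  assumes zero: "trib n = 0"
  shows "n \<in> {- 17, - 4, - 1, 0}"
proof -
  have unique_29: "n = i" if "n mod 140 = i mod 140" "trib i = 0" "\<not> 29 ^ 2 dvd trib (i + 140)" for i
    using unique_zero_in_class[OF _ _ trib_period_29 tribonacci_like_trib that(2) zero] that
    by simp
  have unique_17: "n = i" if "n mod 96 = i mod 96" "trib i = 0" "\<not> 17 ^ 2 dvd trib (i + 96)" for i
    using unique_zero_in_class[OF _ _ trib_period_17 tribonacci_like_trib that(2) zero] that
    by simp
  have "zero_residues 29 140 0 0 1 1 = [0, 77, 123, 136, 139]" by code_simp
  then have "n mod 140 \<in> {0, 77, 123, 136, 139}"
    using zero_mod_period[OF trib_period_29 _ tribonacci_like_trib zero]
    by (simp add: trib_0 trib_1 trib_2)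
  then consider "n mod 140 \<in> {0, 136, 139}" | "n mod 140 \<in> {77, 123}" by blast
  then show ?thesis
  proof cases
    case 1
    have "\<not> 29 ^ 2 dvd tribonacci_iterate 140 0 1 1" "\<not> 29 ^ 2 dvd tribonacci_iterate 136 0 1 1"
      "\<not> 29 ^ 2 dvd tribonacci_iterate 139 0 1 1" by code_simp+
    with 1 show ?thesis
      using unique_29[of 0] unique_29[of "- 4"] unique_29[of "- 1"]
        trib_eval[of 140] trib_eval[of 136] trib_eval[of 139]
      by (auto simp: trib_0 trib_negative_values)
  next
    case 2
    have "zero_residues 17 96 0 0 1 1 = [0, 28, 79, 92, 95]" by code_simp
    then have "n mod 96 \<in> {0, 28, 79, 92, 95}"
      using zero_mod_period[OF trib_period_17 _ tribonacci_like_trib zero]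
      by (simp add: trib_0 trib_1 trib_2)
    moreover have "odd n"
    proof -
      have "n mod 140 mod 2 = n mod 2" by (rule mod_mod_cancel) simp
      with 2 show ?thesis by (auto simp: odd_iff_mod_2_eq_one)
    qed
    moreover have "n mod 96 mod 2 = n mod 2" by (rule mod_mod_cancel) simp
    ultimately have "n mod 96 \<in> {79, 95}" by (auto simp: odd_iff_mod_2_eq_one)
    moreover have "\<not> 17 ^ 2 dvd tribonacci_iterate 79 0 1 1" "\<not> 17 ^ 2 dvd tribonacci_iterate 95 0 1 1"
      by code_simp+
    ultimately show ?thesis
      using unique_17[of "- 17"] unique_17[of "- 1"] trib_eval[of 79] trib_eval[of 95]
      by (auto simp: trib_negative_values)
  qed
qed

text \<open>
  Modulo \<open>29\<close> the zeros \<open>0\<close> and \<open>-2\<close> are alone in their classes modulo \<open>140\<close>. The periods \<open>140\<close> and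
  \<open>360\<close> share the divisor \<open>20\<close>, and the classes \<open>21, 54, 112\<close> are \<open>1, 14, 12\<close> modulo \<open>20\<close>, which do
  not occur among the zeros modulo \<open>19\<close>.
\<close>

theorem trib_pair_sum_zeros:
  assumes zero: "trib (n - 1) + trib n = 0"
  shows "n \<in> {- 2, 0}"
proof -
  define f where "f n = trib (n - 1) + trib n" for n
  have f: "tribonacci_like f"
    using tribonacci_like_add[OF tribonacci_like_shift[OF tribonacci_like_trib, of "- 1"] tribonacci_like_trib]
    by (simp add: f_def[abs_def])
  have init: "f 0 = 0" "f 1 = 1" "f 2 = 2" and "f (- 2) = 0" and "f n = 0"
    using zero by (simp_all add: f_def trib_negative_values trib_0 trib_1 trib_2)
  have f_eval: "f (int l) = tribonacci_iterate l 0 1 2" for l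
    using tribonacci_iterate[OF f, of l 0] by (simp add: init)
  have unique: "n = i" if "n mod 140 = i mod 140" "f i = 0" "\<not> 29 ^ 2 dvd f (i + 140)" for i
    using unique_zero_in_class[OF _ _ trib_period_29 f that(2) \<open>f n = 0\<close>] that
    by simp
  have "zero_residues 29 140 0 0 1 2 = [0, 21, 54, 112, 138]" by code_simp
  then have mod_140: "n mod 140 \<in> {0, 21, 54, 112, 138}"
    using zero_mod_period[OF trib_period_29 _ f \<open>f n = 0\<close>] by (simp add: init)
  have "zero_residues 19 360 0 0 1 2 = [0, 24, 67, 97, 106, 118, 120, 144, 187, 217, 226, 238,
      240, 264, 307, 337, 346, 358]" by code_simp
  then have "n mod 360 \<in> {0, 24, 67, 97, 106, 118, 120, 144, 187, 217, 226, 238,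
      240, 264, 307, 337, 346, 358}"
    using zero_mod_period[OF trib_period_19 _ f \<open>f n = 0\<close>] by (simp add: init)
  moreover have "n mod 360 mod 20 = n mod 20" by (rule mod_mod_cancel) simp
  ultimately have "n mod 20 \<in> {0, 4, 6, 7, 17, 18}" by auto
  moreover have "n mod 140 mod 20 = n mod 20" by (rule mod_mod_cancel) simp
  ultimately have "n mod 140 \<in> {0, 138}" using mod_140 by auto
  moreover have "\<not> 29 ^ 2 dvd tribonacci_iterate 140 0 1 2" "\<not> 29 ^ 2 dvd tribonacci_iterate 138 0 1 2"
    by code_simp+
  ultimately show ?thesis
    using unique[of 0] unique[of "- 2"] f_eval[of 140] f_eval[of 138] init \<open>f (- 2) = 0\<close> by auto
qed

section \<open>The six identities\<close>

theorem theorem5: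
  fixes k :: nat and m r :: int
  assumes r: "r \<notin> {-17, -4, -1, 0}"
  shows
    "((\<Sum>j=0..k. \<Sum>s=0..j.
        real (k choose j) * real (j choose s)
        * real_of_int (trib (r - 1) + trib r) ^ (j - s)
        * (real_of_int (trib (r + 1)) ^ s / real_of_int (trib r) ^ j)
        * real_of_int (trib (m - (r + 2) * int k + int j + int s)))
      = real_of_int (trib m) / real_of_int (trib r) ^ k) \<and>
     (r \<noteq> -2 \<longrightarrow>
     (\<Sum>j=0..k. \<Sum>s=0..j.
        real (k choose j) * real (j choose s)
        * (real_of_int (trib r) ^ (j - s) * real_of_int (trib (r + 1)) ^ s
           / real_of_int (trib (r - 1) + trib r) ^ j)
        * real_of_int (trib (m - (r + 1) * int k - int j + 2 * int s)))
      = real_of_int (trib m) / real_of_int (trib (r - 1) + trib r) ^ k) \<and>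
     ((\<Sum>j=0..k. \<Sum>s=0..j.
        real (k choose j) * real (j choose s)
        * (real_of_int (trib (r - 1)) ^ (j - s)
           * real_of_int (trib (r - 2) + trib (r - 1)) ^ s
           / real_of_int (trib r) ^ j)
        * real_of_int (trib (m - (r - 1) * int k - 2 * int j + int s)))
      = real_of_int (trib m) / real_of_int (trib r) ^ k) \<and>
     ((\<Sum>j=0..k. \<Sum>s=0..j.
        (-1) ^ s * real (k choose j) * real (j choose s)
        * (real_of_int (trib (r - 1) + trib r) ^ (j - s) / real_of_int (trib r) ^ j)
        * real_of_int (trib (m - 2 * int k + int j + (r + 1) * int s)))
      = (-1) ^ k * (real_of_int (trib (r + 1)) / real_of_int (trib r)) ^ k
        * real_of_int (trib m)) \<and>
     ((\<Sum>j=0..k. \<Sum>s=0..j.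
        (-1) ^ s * real (k choose j) * real (j choose s)
        * (real_of_int (trib (r + 1)) ^ (j - s) / real_of_int (trib r) ^ j)
        * real_of_int (trib (m - int k + 2 * int j + r * int s)))
      = (-1) ^ k * (real_of_int (trib (r - 1) + trib r) / real_of_int (trib r)) ^ k
        * real_of_int (trib m)) \<and>
     (r \<noteq> -2 \<longrightarrow>
     (\<Sum>j=0..k. \<Sum>s=0..j.
        (-1) ^ s * real (k choose j) * real (j choose s)
        * (real_of_int (trib (r + 1)) ^ (j - s)
           / real_of_int (trib (r - 1) + trib r) ^ j)
        * real_of_int (trib (m + int k + int j + r * int s)))
      = (-1) ^ k * (real_of_int (trib r) / real_of_int (trib (r - 1) + trib r)) ^ k
        * real_of_int (trib m))"
proof -
  define a b c where "a = real_of_int (trib r)" and "b = real_of_int (trib (r - 1) + trib r)"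
    and "c = real_of_int (trib (r + 1))"
  define f where "f n = real_of_int (trib n)" for n
  have f: "tribonacci_like f"
    unfolding f_def[abs_def] by (rule tribonacci_like_of_int[OF tribonacci_like_trib])
  have a: "a \<noteq> 0" using trib_zeros[of r] r by (auto simp: a_def)
  have b: "b \<noteq> 0" if "r \<noteq> - 2" using trib_pair_sum_zeros[of r] r that by (auto simp: b_def simp flip: of_int_add)
  have rel: "f (m + r + 2) = a * f m + b * f (m + 1) + c * f (m + 2)" for m
    using tribonacci_like_addition[OF f, of m r] by (simp add: a_def b_def c_def)
  define a' b' where "a' = real_of_int (trib (r - 1))" and "b' = real_of_int (trib (r - 2) + trib (r - 1))"
  have rel': "f (m + r + 1) = a' * f m + b' * f (m + 1) + a * f (m + 2)" for m
    using tribonacci_like_addition[OF f, of m "r - 1"] by (simp add: a_def a'_def b'_def algebra_simps)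
  (* Each instance isolates one term of the addition formula, up to sign, and makes the coefficient of
     another term the denominator; the last argument is the base point for which the right-hand
     side of the expansion is a multiple of f m. The third identity takes the formula at r - 1. *)
  have 1: "(\<Sum>j=0..k. \<Sum>s=0..j. real (k choose j) * real (j choose s)
      * b ^ (j - s) * (c ^ s / a ^ j) * f (m - (r + 2) * int k + int j + int s)) = f m / a ^ k"
    using trinomial_expansion_quotient[of a 1 f "r + 2" 0 b 1 c 2 k "m - (r + 2) * int k"] a rel
    by (simp add: power_one_over mult.assoc add.assoc)
  have 2: "(\<Sum>j=0..k. \<Sum>s=0..j. real (k choose j) * real (j choose s)
      * (a ^ (j - s) * c ^ s / b ^ j) * f (m - (r + 1) * int k - int j + 2 * int s)) = f m / b ^ k"
    if "r \<noteq> - 2"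
    using trinomial_expansion_quotient[of b 1 f "r + 2" 1 a 0 c 2 k "m - (r + 2) * int k"] b[OF that] rel
    by (simp add: power_one_over algebra_simps)
  have 3: "(\<Sum>j=0..k. \<Sum>s=0..j. real (k choose j) * real (j choose s)
      * (a' ^ (j - s) * b' ^ s / a ^ j) * f (m - (r - 1) * int k - 2 * int j + int s)) = f m / a ^ k"
    using trinomial_expansion_quotient[of a 1 f "r + 1" 2 a' 0 b' 1 k "m - (r + 1) * int k"] a rel'
    by (simp add: power_one_over algebra_simps)
  have 4: "(\<Sum>j=0..k. \<Sum>s=0..j. (- 1) ^ s * real (k choose j) * real (j choose s)
      * (b ^ (j - s) / a ^ j) * f (m - 2 * int k + int j + (r + 1) * int s)) = (- 1) ^ k * (c / a) ^ k * f m"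
    using trinomial_expansion_quotient[of a "- c" f 2 0 b 1 "- 1" "r + 2" k "m - 2 * int k"] a rel
    by (simp add: power_minus[of "c / a"] algebra_simps)
  have 5: "(\<Sum>j=0..k. \<Sum>s=0..j. (- 1) ^ s * real (k choose j) * real (j choose s)
      * (c ^ (j - s) / a ^ j) * f (m - int k + 2 * int j + r * int s)) = (- 1) ^ k * (b / a) ^ k * f m"
    using trinomial_expansion_quotient[of a "- b" f 1 0 c 2 "- 1" "r + 2" k "m - int k"] a rel
    by (simp add: power_minus[of "b / a"] algebra_simps)
  have 6: "(\<Sum>j=0..k. \<Sum>s=0..j. (- 1) ^ s * real (k choose j) * real (j choose s)
      * (c ^ (j - s) / b ^ j) * f (m + int k + int j + r * int s)) = (- 1) ^ k * (a / b) ^ k * f m"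
    if "r \<noteq> - 2"
    using trinomial_expansion_quotient[of b "- a" f 0 1 c 2 "- 1" "r + 2" k m] b[OF that] rel
    by (simp add: power_minus[of "a / b"] algebra_simps)
  show ?thesis
    using 1 2 3 4 5 6 unfolding a_def b_def c_def a'_def b'_def f_def by blast
qed

end
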